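(* Assume that there exists $\nu>0$ such that $a_\theta[w]\ge \nu\|w\|_\theta^2$ for all $w\in W_\theta$ and all $\theta\in\Theta$. Let $0<\varepsilon<1$, $\theta\in\Theta$, $f\in H^*$; let $u_{\varepsilon,\theta}\in H$ be the solution of $$\varepsilon^{-2}a_\theta(u_{\varepsilon,\theta},\tilde u)+b_\theta(u_{\varepsilon,\theta},\tilde u)=\langle f,\tilde u\rangle\qquad\forall \tilde u\in H,$$ and let $v_\theta\in V_\theta$ be the solution of $$b_\theta(v_\theta,\tilde v)=\langle f,\tilde v\rangle\qquad \forall \tilde v\in V_\theta .$$ Then $$\varepsilon^{-2}a_\theta[u_{\varepsilon,\theta}-v_\theta]+b_\theta[u_{\varepsilon,\theta}-v_\theta]\le \varepsilon^2\nu^{-1}\|f\|_{*\theta}^2,\qquad \|u_{\varepsilon,\theta}-v_\theta\|_\theta^2\le\varepsilon^4\nu^{-2}\|f\|_{*\theta}^2 .$$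
   Context: $H$ is a separable complex Hilbert space, $n\ge 1$, $\Theta\subset\mathbb R^n$ is compact, and for each $\theta\in\Theta$, $a_\theta$ and $b_\theta$ are non-negative sesquilinear forms on $H\times H$. For a sesquilinear form $\mathfrak b$ write $\mathfrak b[u]:=\mathfrak b(u,u)$. Standing assumptions: for each $\theta$, $(u,\tilde u)_\theta:=a_\theta(u,\tilde u)+b_\theta(u,\tilde u)$ is an inner product on $H$ equivalent to the original one, with norm $\|\cdot\|_\theta$; there is $K>0$ with $\|u\|_{\theta_1}\le K\|u\|_{\theta_2}$ for all $u\in H$, $\theta_1,\theta_2\in\Theta$; there is $L_a>0$ with $|a_{\theta_1}(u,\tilde u)-a_{\theta_2}(u,\tilde u)|\le L_a|\theta_1-\theta_2|\,\|u\|_{\theta_1}\|\tilde u\|_{\theta_1}$ for all $u,\tilde u\in H$, $\theta_1,\theta_2\in\Theta$. $H^*$ is the space of antilinear continuous functionals on $H$, $\langle\cdot,\cdot\rangle$ is the duality pairing, and $\|f\|_{*\theta}:=\sup_{u\in H\setminus\{0\}}|\langle f,u\rangle|/\|u\|_\theta$. $V_\theta:=\{v\in H: a_\theta[v]=0\}$ (a closed subspace), and $W_\theta:=\{w\in H:(w,v)_\theta=0\ \forall v\in V_\theta\}$. *)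

theory Defs
  imports "HOL-Analysis.Analysis"
begin

class complex_vector = real_vector +
  fixes scaleC :: "complex \<Rightarrow> 'a \<Rightarrow> 'a"  (infixr "*\<^sub>C" 75)
  assumes scaleC_add_right: "c *\<^sub>C (x + y) = c *\<^sub>C x + c *\<^sub>C y"
    and scaleC_add_left: "(c + d) *\<^sub>C x = c *\<^sub>C x + d *\<^sub>C x"
    and scaleC_scaleC: "c *\<^sub>C (d *\<^sub>C x) = (c * d) *\<^sub>C x"
    and scaleC_of_real: "complex_of_real r *\<^sub>C x = r *\<^sub>R x"

text \<open>
  Inner products, and sesquilinear forms in general, are linear in the first and antilinear in the
  second argument. Positive definiteness of \<open>cinner\<close> is contained in \<open>cinner_self\<close>, because
  \<open>norm\<close> is already a norm.
\<close>

class complex_inner = complex_vector + real_normed_vector +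
  fixes cinner :: "'a \<Rightarrow> 'a \<Rightarrow> complex"
  assumes cinner_add_left: "cinner (x + y) z = cinner x z + cinner y z"
    and cinner_scaleC_left: "cinner (c *\<^sub>C x) y = c * cinner x y"
    and cinner_commute: "cinner y x = cnj (cinner x y)"
    and cinner_self: "cinner x x = complex_of_real ((norm x)\<^sup>2)"

class complex_hilbert = complex_inner + complete_space

definition sesquilinear :: "('h::complex_vector \<Rightarrow> 'h \<Rightarrow> complex) \<Rightarrow> bool" where
  "sesquilinear s \<longleftrightarrow>
     (\<forall>x y z. s (x + y) z = s x z + s y z) \<and>
     (\<forall>c x y. s (c *\<^sub>C x) y = c * s x y) \<and>
     (\<forall>x y z. s x (y + z) = s x y + s x z) \<and>
     (\<forall>c x y. s x (c *\<^sub>C y) = cnj c * s x y)"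

definition nonneg_form :: "('h::complex_vector \<Rightarrow> 'h \<Rightarrow> complex) \<Rightarrow> bool" where
  "nonneg_form s \<longleftrightarrow> sesquilinear s \<and> (\<forall>u. s u u \<in> \<real>\<^sub>\<ge>\<^sub>0)"

definition inner_product_form :: "('h::complex_vector \<Rightarrow> 'h \<Rightarrow> complex) \<Rightarrow> bool" where
  "inner_product_form s \<longleftrightarrow>
     sesquilinear s \<and> (\<forall>u v. s v u = cnj (s u v)) \<and> (\<forall>u. u \<noteq> 0 \<longrightarrow> 0 < Re (s u u))"

text \<open>For a non-negative form \<open>s u u\<close> is real, so taking the real part only changes the type.\<close>

definition quad :: "('h \<Rightarrow> 'h \<Rightarrow> complex) \<Rightarrow> 'h \<Rightarrow> real" where
  "quad s u = Re (s u u)"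

definition sum_form ::
    "('h \<Rightarrow> 'h \<Rightarrow> complex) \<Rightarrow> ('h \<Rightarrow> 'h \<Rightarrow> complex) \<Rightarrow> 'h \<Rightarrow> 'h \<Rightarrow> complex" where
  "sum_form a b u v = a u v + b u v"

definition form_norm :: "('h \<Rightarrow> 'h \<Rightarrow> complex) \<Rightarrow> 'h \<Rightarrow> real" where
  "form_norm s u = sqrt (quad s u)"

definition equivalent_to_norm :: "('h::real_normed_vector \<Rightarrow> 'h \<Rightarrow> complex) \<Rightarrow> bool" where
  "equivalent_to_norm s \<longleftrightarrow>
     (\<exists>c>0. \<exists>C>0. \<forall>u. c * norm u \<le> form_norm s u \<and> form_norm s u \<le> C * norm u)"

definition antidual :: "('h::complex_inner \<Rightarrow> complex) set" where
  "antidual = {f. (\<forall>x y. f (x + y) = f x + f y) \<and> (\<forall>c x. f (c *\<^sub>C x) = cnj c * f x) \<and>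
                  continuous_on UNIV f}"

text \<open>
  As in \<open>onorm\<close>, the supremum runs over all \<open>u\<close>: the term for \<open>u = 0\<close> is \<open>0 / 0 = 0\<close>, which does
  not affect the supremum over \<open>u \<noteq> 0\<close>, and gives the value \<open>0\<close> on the zero space.
\<close>

definition dual_norm :: "('h \<Rightarrow> 'h \<Rightarrow> complex) \<Rightarrow> ('h \<Rightarrow> complex) \<Rightarrow> real" where
  "dual_norm s f = (SUP u. cmod (f u) / form_norm s u)"

definition null_space :: "('h \<Rightarrow> 'h \<Rightarrow> complex) \<Rightarrow> 'h set" where
  "null_space a = {v. a v v = 0}"

definition orth_space ::
    "('h \<Rightarrow> 'h \<Rightarrow> complex) \<Rightarrow> ('h \<Rightarrow> 'h \<Rightarrow> complex) \<Rightarrow> 'h set" where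
  "orth_space a b = {w. \<forall>v \<in> null_space a. sum_form a b w v = 0}"

end

(* The error r = u - v is itself orthogonal to the null space V: the forms a vanish against V, so both
   equations tested on V read b(u, z) = f(z) = b(v, z). Testing the equation for u with r therefore
   gives E = a[r] / eps^2 + b[r] = f(r) <= D |r|, where D is the dual norm of f, while coercivity on W
   gives E >= nu |r|^2 / eps^2. Hence |r| <= eps^2 D / nu, and then E <= D |r| <= eps^2 D^2 / nu. *)
theory Submission
  imports Defs
begin

lemma sesquilinear_diff_left:
  assumes "sesquilinear s"
  shows "s (x - y) z = s x z - s y z"
proof -
  have "s ((x - y) + y) z = s (x - y) z + s y z"
    using assms unfolding sesquilinear_def by blast
  then show ?thesis by simp
qed

text \<open>Polarization with real diagonal values: the diagonal at \<open>x + y\<close> forces the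
  imaginary parts of \<open>s x y\<close> and \<open>s y x\<close> to be opposite, and the diagonal
  at \<open>x + \<i> *\<^sub>C y\<close> forces their real parts to agree.\<close>

lemma nonneg_form_hermitian:
  assumes "nonneg_form s"
  shows "s y x = cnj (s x y)"
proof -
  have add: "\<And>x y z. s (x + y) z = s x z + s y z" "\<And>x y z. s x (y + z) = s x y + s x z"
    and scale: "\<And>c x y. s (c *\<^sub>C x) y = c * s x y" "\<And>c x y. s x (c *\<^sub>C y) = cnj c * s x y"
    using assms unfolding nonneg_form_def sesquilinear_def by blast+
  have real: "Im (s w w) = 0" for w
    using assms unfolding nonneg_form_def by (auto simp: complex_nonneg_Reals_iff)
  have "Im (s x y) + Im (s y x) = 0"
    using real[of "x + y"] real[of x] real[of y] by (simp add: add)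
  moreover have "Re (s y x) = Re (s x y)"
    using real[of "x + \<i> *\<^sub>C y"] real[of x] real[of y] by (simp add: add scale)
  ultimately show ?thesis by (simp add: complex_eq_iff)
qed

text \<open>Since \<open>s v v = 0\<close>, the diagonal value at \<open>z + c *\<^sub>C v\<close>
  has no quadratic term in \<open>c\<close>. A nonzero linear term could therefore drive it below
  zero, against non-negativity.\<close>

lemma nonneg_form_null_left:
  assumes s: "nonneg_form s" and v: "s v v = 0"
  shows "s v z = 0"
proof (rule ccontr)
  assume nz: "s v z \<noteq> 0"
  have add: "\<And>x y z. s (x + y) z = s x z + s y z" "\<And>x y z. s x (y + z) = s x y + s x z"
    and scale: "\<And>c x y. s (c *\<^sub>C x) y = c * s x y" "\<And>c x y. s x (c *\<^sub>C y) = cnj c * s x y"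
    using s unfolding nonneg_form_def sesquilinear_def by blast+
  \<comment> \<open>The factor \<open>cnj (s v z)\<close> in \<open>c\<close> makes
    \<open>c * s v z\<close> real and negative. The size of \<open>t\<close> is chosen so that the
    two conjugate cross terms together subtract \<open>Re (s z z) + 1\<close>, which leaves exactly
    \<open>-1\<close>.\<close>
  define t where "t = (Re (s z z) + 1) / (2 * (cmod (s v z))\<^sup>2)"
  define c where "c = - complex_of_real t * cnj (s v z)"
  have cs: "c * s v z = - complex_of_real (t * (cmod (s v z))\<^sup>2)"
    unfolding c_def by (simp add: complex_norm_square ac_simps del: of_real_power)
  have "s (z + c *\<^sub>C v) (z + c *\<^sub>C v) = s z z + c * s v z + cnj (c * s v z)"
    using v nonneg_form_hermitian[OF s, of z v] by (simp add: add scale)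
  then have "Re (s (z + c *\<^sub>C v) (z + c *\<^sub>C v)) = Re (s z z) - 2 * (t * (cmod (s v z))\<^sup>2)"
    by (simp only: cs) simp
  also have "\<dots> = -1"
    using nz by (simp add: t_def field_simps)
  finally have "Re (s (z + c *\<^sub>C v) (z + c *\<^sub>C v)) = -1" .
  moreover have "0 \<le> Re (s (z + c *\<^sub>C v) (z + c *\<^sub>C v))"
    using s unfolding nonneg_form_def by (auto simp: complex_nonneg_Reals_iff)
  ultimately show False by simp
qed

lemma antidual_bounded:
  fixes f :: "'h::complex_inner \<Rightarrow> complex"
  assumes "f \<in> antidual"
  obtains M where "\<And>x. cmod (f x) \<le> M * norm x"
proof -
  have f: "\<And>x y. f (x + y) = f x + f y" "\<And>c x. f (c *\<^sub>C x) = cnj c * f x"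
    and cont: "continuous_on UNIV f"
    using assms unfolding antidual_def by auto
  have scaleR: "f (r *\<^sub>R x) = r *\<^sub>R f x" for r x
    using f(2)[of "complex_of_real r" x] by (simp add: scaleC_of_real scaleR_conv_of_real)
  have f0: "f 0 = 0"
    using f(1)[of 0 0] by simp
  obtain d where "d > 0" and d: "\<And>x. norm x < d \<Longrightarrow> cmod (f x) < 1"
    using cont f0 unfolding continuous_on_iff
    by (metis UNIV_I dist_0_norm dist_commute zero_less_one)
  \<comment> \<open>Rescaling \<open>x\<close> to norm \<open>d / 2\<close> puts it strictly inside
    the ball where \<open>f\<close> is below 1; undoing the scaling gives the constant
    \<open>2 / d\<close>.\<close>
  have "cmod (f x) \<le> 2 / d * norm x" for x
  proof (cases "x = 0")
    case False
    have "cmod (f ((d / 2 / norm x) *\<^sub>R x)) < 1"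
      by (rule d) (use False \<open>d > 0\<close> in simp)
    with False \<open>d > 0\<close> show ?thesis
      by (simp add: scaleR field_simps)
  qed (simp add: f0)
  then show thesis by (rule that)
qed

text \<open>A real supremum dominates its terms only once the range is known to be bounded above.
  Boundedness of \<open>f\<close> and the lower bound \<open>c * norm x\<close> for the form norm
  provide this.\<close>

lemma divide_form_norm_le_dual_norm:
  assumes f: "f \<in> antidual" and s: "equivalent_to_norm s"
  shows "cmod (f x) / form_norm s x \<le> dual_norm s f"
proof -
  obtain M where M: "\<And>x. cmod (f x) \<le> M * norm x"
    using antidual_bounded[OF f] by blast
  obtain c where "c > 0" and c: "\<And>x. c * norm x \<le> form_norm s x"
    using s unfolding equivalent_to_norm_def by blast
  \<comment> \<open>The absolute value is taken because the sign of \<open>M\<close> is unknown: on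
    the zero space a negative \<open>M\<close> is possible.\<close>
  have "cmod (f x) / form_norm s x \<le> \<bar>M\<bar> / c" for x
  proof (cases "x = 0")
    case True
    then show ?thesis using M[of 0] \<open>c > 0\<close> by simp
  next
    case False
    have "cmod (f x) \<le> \<bar>M\<bar> * norm x"
      using M[of x] by (smt (verit) mult_right_mono norm_ge_zero)
    then show ?thesis
      using frac_le[OF _ _ _ c, of "\<bar>M\<bar> * norm x" "cmod (f x)" x] False \<open>c > 0\<close> by simp
  qed
  then have "bdd_above (range (\<lambda>x. cmod (f x) / form_norm s x))"
    by (intro bdd_aboveI2)
  then show ?thesis
    unfolding dual_norm_def by (rule cSUP_upper[OF UNIV_I])
qed

text \<open>The quotient at \<open>0\<close> has numerator \<open>f 0 = 0\<close>, so the value 0 is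
  among those over which the supremum runs, even on the zero space.\<close>

lemma dual_norm_nonneg:
  assumes "f \<in> antidual" and "equivalent_to_norm s"
  shows "0 \<le> dual_norm s f"
proof -
  have "f 0 = 0"
    using antidual_bounded[OF assms(1)] by (metis mult_zero_right norm_le_zero_iff norm_zero)
  then show ?thesis
    using divide_form_norm_le_dual_norm[OF assms, of 0] by simp
qed

lemma cmod_le_dual_norm:
  assumes f: "f \<in> antidual" and s: "equivalent_to_norm s"
  shows "cmod (f x) \<le> dual_norm s f * form_norm s x"
proof -
  obtain c where "c > 0" and c: "\<And>x. c * norm x \<le> form_norm s x"
    using s unfolding equivalent_to_norm_def by blast
  show ?thesis
  proof (cases "x = 0")
    case True
    have "f 0 = 0"
      using antidual_bounded[OF f] by (metis mult_zero_right norm_le_zero_iff norm_zero)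
    moreover have "0 \<le> form_norm s x" using c[of x] True by simp
    ultimately show ?thesis using True dual_norm_nonneg[OF f s] by simp
  next
    case False
    then have "form_norm s x > 0"
      using c[of x] \<open>c > 0\<close> by (smt (verit) mult_pos_pos zero_less_norm_iff)
    then show ?thesis
      using divide_form_norm_le_dual_norm[OF f s, of x] by (simp add: pos_divide_le_eq)
  qed
qed

theorem theorem3p1:
  fixes \<Theta> :: "(real ^ 'n) set"
    and a b :: "real ^ 'n \<Rightarrow> 'h::complex_hilbert \<Rightarrow> 'h \<Rightarrow> complex"
    and K L\<^sub>a \<nu> \<epsilon> :: real
    and \<theta> :: "real ^ 'n"
    and f :: "'h \<Rightarrow> complex"
    and u v :: 'h
  assumes "separable_space (euclidean :: 'h topology)"
    and "compact \<Theta>"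
    and "\<And>\<theta>. \<theta> \<in> \<Theta> \<Longrightarrow> nonneg_form (a \<theta>)"
    and "\<And>\<theta>. \<theta> \<in> \<Theta> \<Longrightarrow> nonneg_form (b \<theta>)"
    and "\<And>\<theta>. \<theta> \<in> \<Theta> \<Longrightarrow> inner_product_form (sum_form (a \<theta>) (b \<theta>))"
    and "\<And>\<theta>. \<theta> \<in> \<Theta> \<Longrightarrow> equivalent_to_norm (sum_form (a \<theta>) (b \<theta>))"
    and "K > 0"
    and "\<And>\<theta>\<^sub>1 \<theta>\<^sub>2 x. \<theta>\<^sub>1 \<in> \<Theta> \<Longrightarrow> \<theta>\<^sub>2 \<in> \<Theta> \<Longrightarrow>
           form_norm (sum_form (a \<theta>\<^sub>1) (b \<theta>\<^sub>1)) x \<le> K * form_norm (sum_form (a \<theta>\<^sub>2) (b \<theta>\<^sub>2)) x"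
    and "L\<^sub>a > 0"
    and "\<And>\<theta>\<^sub>1 \<theta>\<^sub>2 x y. \<theta>\<^sub>1 \<in> \<Theta> \<Longrightarrow> \<theta>\<^sub>2 \<in> \<Theta> \<Longrightarrow>
           cmod (a \<theta>\<^sub>1 x y - a \<theta>\<^sub>2 x y) \<le> L\<^sub>a * norm (\<theta>\<^sub>1 - \<theta>\<^sub>2) *
             form_norm (sum_form (a \<theta>\<^sub>1) (b \<theta>\<^sub>1)) x * form_norm (sum_form (a \<theta>\<^sub>1) (b \<theta>\<^sub>1)) y"
    and "\<nu> > 0"
    and "\<And>\<theta> w. \<theta> \<in> \<Theta> \<Longrightarrow> w \<in> orth_space (a \<theta>) (b \<theta>) \<Longrightarrow>
           quad (a \<theta>) w \<ge> \<nu> * (form_norm (sum_form (a \<theta>) (b \<theta>)) w)\<^sup>2"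
    and "0 < \<epsilon>" and "\<epsilon> < 1"
    and "\<theta> \<in> \<Theta>"
    and "f \<in> antidual"
    and "\<forall>z. complex_of_real (1 / \<epsilon>\<^sup>2) * a \<theta> u z + b \<theta> u z = f z"
    and "v \<in> null_space (a \<theta>)"
    and "\<forall>z \<in> null_space (a \<theta>). b \<theta> v z = f z"
  shows "1 / \<epsilon>\<^sup>2 * quad (a \<theta>) (u - v) + quad (b \<theta>) (u - v)
           \<le> \<epsilon>\<^sup>2 * (1 / \<nu>) * (dual_norm (sum_form (a \<theta>) (b \<theta>)) f)\<^sup>2
       \<and> (form_norm (sum_form (a \<theta>) (b \<theta>)) (u - v))\<^sup>2
           \<le> \<epsilon>^4 * (1 / \<nu>\<^sup>2) * (dual_norm (sum_form (a \<theta>) (b \<theta>)) f)\<^sup>2"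
proof -
  define A B where "A = a \<theta>" and "B = b \<theta>"
  define r where "r = u - v"
  define D n where "D = dual_norm (sum_form A B) f" and "n = form_norm (sum_form A B) r"
  define E where "E = 1 / \<epsilon>\<^sup>2 * quad A r + quad B r"
  note nn = assms(3,4)[OF \<open>\<theta> \<in> \<Theta>\<close>, folded A_def B_def]
  note sesq = nn[unfolded nonneg_form_def, THEN conjunct1]
  note eq_u = \<open>\<forall>z. complex_of_real (1 / \<epsilon>\<^sup>2) * a \<theta> u z + b \<theta> u z = f z\<close>[folded A_def B_def, rule_format]
  note eq_v = \<open>\<forall>z \<in> null_space (a \<theta>). b \<theta> v z = f z\<close>[folded A_def B_def, rule_format]
  have v: "v \<in> null_space A"
    using \<open>v \<in> null_space (a \<theta>)\<close> by (simp add: A_def)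
  have A_null: "A z x = 0" "A x z = 0" if "z \<in> null_space A" for x z
    using nonneg_form_null_left[OF nn(1), of z x] nonneg_form_hermitian[OF nn(1), of x z] that
    by (auto simp: null_space_def)
  have B_orth: "B r z = 0" if "z \<in> null_space A" for z
    using eq_u[of z] eq_v[OF that] A_null(2)[OF that, of u]
    by (simp add: r_def sesquilinear_diff_left[OF sesq(2)])
  then have "r \<in> orth_space A B"
    by (simp add: orth_space_def sum_form_def A_null)
  then have coercive: "\<nu> * n\<^sup>2 \<le> quad A r"
    using assms(12)[OF \<open>\<theta> \<in> \<Theta>\<close>, of r] by (simp add: n_def A_def B_def)
  have quad_nonneg: "0 \<le> quad A r" "0 \<le> quad B r"
    using nn by (auto simp: nonneg_form_def quad_def complex_nonneg_Reals_iff)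
  have n: "0 \<le> n"
    using quad_nonneg by (simp add: n_def form_norm_def quad_def sum_form_def)
  have fr: "cmod (f r) \<le> D * n"
    unfolding D_def n_def A_def B_def
    by (rule cmod_le_dual_norm[OF \<open>f \<in> antidual\<close> assms(6)[OF \<open>\<theta> \<in> \<Theta>\<close>]])
  \<comment> \<open>The contribution of \<open>v\<close> to the first argument drops out of both
    forms: from \<open>A\<close> because \<open>v\<close> is a null vector, from \<open>B\<close>
    because \<open>B v r\<close> is the conjugate of \<open>B r v = 0\<close>. So the energy of
    \<open>r\<close> is the left side of the equation for \<open>u\<close> tested with
    \<open>r\<close>.\<close>
  have "A r r = A u r"
    using sesquilinear_diff_left[OF sesq(1), of u v r] A_null(1)[OF v, of r] by (simp add: r_def)
  moreover have "B r r = B u r"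
    using sesquilinear_diff_left[OF sesq(2), of u v r] nonneg_form_hermitian[OF nn(2), of v r] B_orth[OF v]
    by (simp add: r_def)
  ultimately have "complex_of_real (1 / \<epsilon>\<^sup>2) * A r r + B r r = f r"
    using eq_u[of r] by simp
  then have "E = Re (f r)"
    unfolding E_def quad_def by (metis Re_complex_of_real times_complex.sel(1) Im_complex_of_real
        mult_zero_left diff_zero plus_complex.sel(1))
  then have E_le: "E \<le> D * n"
    using complex_Re_le_cmod[of "f r"] fr by linarith
  \<comment> \<open>Here \<open>\<epsilon>\<^sup>2 * E\<close> equals
    \<open>quad A r + \<epsilon>\<^sup>2 * quad B r\<close>, and the second summand is
    non-negative.\<close>
  have "\<nu> * n\<^sup>2 \<le> \<epsilon>\<^sup>2 * E"
    using coercive quad_nonneg \<open>0 < \<epsilon>\<close> by (simp add: E_def field_simps add_increasing2)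
  also have "\<dots> \<le> \<epsilon>\<^sup>2 * (D * n)"
    using E_le by (intro mult_left_mono) auto
  finally have nDn: "(\<nu> * n) * n \<le> (\<epsilon>\<^sup>2 * D) * n"
    by (simp add: power2_eq_square ac_simps)
  have D: "0 \<le> D"
    unfolding D_def A_def B_def
    by (rule dual_norm_nonneg[OF \<open>f \<in> antidual\<close> assms(6)[OF \<open>\<theta> \<in> \<Theta>\<close>]])
  \<comment> \<open>The common factor \<open>n\<close> in \<open>nDn\<close> can be cancelled only
    when it is nonzero; for \<open>n = 0\<close> the sign of \<open>D\<close> suffices.\<close>
  have n_le: "n \<le> \<epsilon>\<^sup>2 * D / \<nu>"
  proof (cases "n = 0")
    case True
    then show ?thesis using D \<open>\<nu> > 0\<close> by simp
  next
    case False
    then have "\<nu> * n \<le> \<epsilon>\<^sup>2 * D"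
      using nDn n mult_right_le_imp_le[of "\<nu> * n" n "\<epsilon>\<^sup>2 * D"] by simp
    then show ?thesis using \<open>\<nu> > 0\<close> by (simp add: field_simps)
  qed
  have "E \<le> D * (\<epsilon>\<^sup>2 * D / \<nu>)"
    using E_le mult_left_mono[OF n_le D] by linarith
  then have "E \<le> \<epsilon>\<^sup>2 * (1 / \<nu>) * D\<^sup>2"
    by (simp add: power2_eq_square ac_simps)
  \<comment> \<open>This is the square of \<open>n_le\<close>, whose two sides are
    non-negative.\<close>
  moreover have "n\<^sup>2 \<le> \<epsilon>^4 * (1 / \<nu>\<^sup>2) * D\<^sup>2"
    using power_mono[OF n_le n, of 2] by (simp add: power_mult_distrib power_divide flip: power_mult)
  ultimately show ?thesis
    by (simp add: E_def n_def D_def r_def A_def B_def)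
qed

end
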